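(* Assume that the system $x_{k+1}=F_kx_k+G_kx_kw_k$, $y_k=H_kx_k$, $k=0,1,2,\dots$, is periodic with period $\tau>0$, i.e. $F_{k+\tau}=F_k$, $G_{k+\tau}=G_k$, $H_{k+\tau}=H_k$ for all $k\ge0$. Let $N\ge 0$ be any fixed integer. If the system is $\mathcal K^{N}$-exactly detectable and $\{P_k>0\}_{k\ge 0}$ is a positive definite matrix sequence which solves the generalized Lyapunov equation $$-P_k+F_k^TP_{k+1}F_k+G_k^TP_{k+1}G_k+H_k^TH_k=0,\qquad k=0,1,2,\dots,$$ then the periodic system is ESMS.
   Context: $\{w_k\}_{k\ge 0}$ is a one-dimensional independent white noise process on a probability space, with $E w_k=0$, $E[w_kw_j]=\delta_{kj}$; $\mathcal F_k=\sigma(w_0,\dots,w_k)$ and $\mathcal F_{-1}$ is the trivial sigma-algebra; $l^2_{\mathcal F_k}$ is the set of $\mathcal F_k$-measurable random vectors $x$ with $E\|x\|^2<\infty$. $F_k,G_k\in\mathbb R^{n\times n}$, $H_k\in\mathbb R^{m\times n}$ are deterministic real matrices; $x_k\in\mathbb R^n$, $y_k\in\mathbb R^m$. $A>0$ means $A$ is real symmetric positive definite. A state $x_{k_0}\in l^2_{\mathcal F_{k_0-1}}$ at time $k_0$ is $k_0^{s_0}$-unobservable if the output generated from it satisfies $y_k=0$ a.s. for all $k\in[k_0,k_0+s_0]$. The system is $k_0^{s_0}$-exactly detectable if there are constants $\beta\ge1$, $0<\lambda<1$ such that for every $k_0^{s_0}$-unobservable state $\xi$ the trajectory with $x_{k_0}=\xi$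 satisfies $E\|x_k\|^2\le\beta E\|\xi\|^2\lambda^{k-k_0}$ for all $k\ge k_0$. For an integer $N\ge0$, the system is $\mathcal K^N$-exactly detectable if it is $k_0^N$-exactly detectable for every $k_0\ge 0$. ESMS (exponentially stable in mean square): there exist $\beta\ge 1$ and $\lambda\in(0,1)$ such that for any $0\le k_0\le k<+\infty$ and any state $x_{k_0}\in l^2_{\mathcal F_{k_0-1}}$ at time $k_0$, the trajectory started from $x_{k_0}$ satisfies $E\|x_k\|^2\le\beta E\|x_{k_0}\|^2\lambda^{k-k_0}$. *)

theory Defs
  imports "HOL-Probability.Probability"
begin

text \<open>The covariance condition already forces square integrability: if \<open>w k\<close> were not
  square integrable, the Bochner integral of \<open>(w k)\<^sup>2\<close> would be 0, not 1.\<close>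

locale white_noise = prob_space M for M :: "'a measure" +
  fixes w :: "nat \<Rightarrow> 'a \<Rightarrow> real"
  assumes indep: "indep_vars (\<lambda>_. borel) w UNIV"
    and mean: "\<And>k. expectation (w k) = 0"
    and covariance: "\<And>k j. expectation (\<lambda>\<omega>. w k \<omega> * w j \<omega>) = (if k = j then 1 else 0)"

text \<open>The index is an integer so that \<open>noise_filtration M w (-1)\<close>, which has no
  generators, is the trivial sigma-algebra.\<close>

definition noise_filtration :: "'a measure \<Rightarrow> (nat \<Rightarrow> 'a \<Rightarrow> real) \<Rightarrow> int \<Rightarrow> 'a measure" where
  "noise_filtration M w i =
     sigma (space M) {w j -` A \<inter> space M | j A. int j \<le> i \<and> A \<in> sets borel}"

definition l2_adapted ::
  "'a measure \<Rightarrow> (nat \<Rightarrow> 'a \<Rightarrow> real) \<Rightarrow> int \<Rightarrow> ('a \<Rightarrow> real ^ 'n) set" where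
  "l2_adapted M w i =
     {x. x \<in> borel_measurable (noise_filtration M w i) \<and> integrable M (\<lambda>\<omega>. (norm (x \<omega>))\<^sup>2)}"

text \<open>The trajectory of \<open>x (k + 1) = F k x k + G k x k w k\<close> with \<open>x k0 = \<xi>\<close>. Only times
  \<open>k \<ge> k0\<close> are meaningful; earlier ones get the dummy value \<open>\<xi>\<close>.\<close>

primrec trajectory ::
  "(nat \<Rightarrow> real ^ 'n ^ 'n) \<Rightarrow> (nat \<Rightarrow> real ^ 'n ^ 'n) \<Rightarrow> (nat \<Rightarrow> 'a \<Rightarrow> real) \<Rightarrow>
   nat \<Rightarrow> ('a \<Rightarrow> real ^ 'n) \<Rightarrow> nat \<Rightarrow> 'a \<Rightarrow> real ^ 'n" where
  "trajectory F G w k0 \<xi> 0 = \<xi>"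
| "trajectory F G w k0 \<xi> (Suc k) =
     (if k < k0 then \<xi>
      else (\<lambda>\<omega>. F k *v trajectory F G w k0 \<xi> k \<omega>
                + w k \<omega> *\<^sub>R (G k *v trajectory F G w k0 \<xi> k \<omega>)))"

definition unobservable_state ::
  "'a measure \<Rightarrow> (nat \<Rightarrow> 'a \<Rightarrow> real) \<Rightarrow> (nat \<Rightarrow> real ^ 'n ^ 'n) \<Rightarrow> (nat \<Rightarrow> real ^ 'n ^ 'n) \<Rightarrow>
   (nat \<Rightarrow> real ^ 'n ^ 'm) \<Rightarrow> nat \<Rightarrow> nat \<Rightarrow> ('a \<Rightarrow> real ^ 'n) \<Rightarrow> bool" where
  "unobservable_state M w F G H k0 s0 \<xi> \<longleftrightarrow>
     \<xi> \<in> l2_adapted M w (int k0 - 1) \<and>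
     (\<forall>k\<in>{k0..k0 + s0}. AE \<omega> in M. H k *v trajectory F G w k0 \<xi> k \<omega> = 0)"

definition exactly_detectable_at ::
  "'a measure \<Rightarrow> (nat \<Rightarrow> 'a \<Rightarrow> real) \<Rightarrow> (nat \<Rightarrow> real ^ 'n ^ 'n) \<Rightarrow> (nat \<Rightarrow> real ^ 'n ^ 'n) \<Rightarrow>
   (nat \<Rightarrow> real ^ 'n ^ 'm) \<Rightarrow> nat \<Rightarrow> nat \<Rightarrow> bool" where
  "exactly_detectable_at M w F G H k0 s0 \<longleftrightarrow>
     (\<exists>\<beta> \<rho> :: real. \<beta> \<ge> 1 \<and> 0 < \<rho> \<and> \<rho> < 1 \<and>
       (\<forall>\<xi>. unobservable_state M w F G H k0 s0 \<xi> \<longrightarrow>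
         (\<forall>k\<ge>k0. (LINT \<omega>|M. (norm (trajectory F G w k0 \<xi> k \<omega>))\<^sup>2)
                    \<le> \<beta> * (LINT \<omega>|M. (norm (\<xi> \<omega>))\<^sup>2) * \<rho> ^ (k - k0))))"

definition K_exactly_detectable ::
  "'a measure \<Rightarrow> (nat \<Rightarrow> 'a \<Rightarrow> real) \<Rightarrow> (nat \<Rightarrow> real ^ 'n ^ 'n) \<Rightarrow> (nat \<Rightarrow> real ^ 'n ^ 'n) \<Rightarrow>
   (nat \<Rightarrow> real ^ 'n ^ 'm) \<Rightarrow> nat \<Rightarrow> bool" where
  "K_exactly_detectable M w F G H N \<longleftrightarrow> (\<forall>k0. exactly_detectable_at M w F G H k0 N)"

definition ESMS ::
  "'a measure \<Rightarrow> (nat \<Rightarrow> 'a \<Rightarrow> real) \<Rightarrow> (nat \<Rightarrow> real ^ 'n ^ 'n) \<Rightarrow> (nat \<Rightarrow> real ^ 'n ^ 'n) \<Rightarrow>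
   bool" where
  "ESMS M w F G \<longleftrightarrow>
     (\<exists>\<beta> \<rho> :: real. \<beta> \<ge> 1 \<and> 0 < \<rho> \<and> \<rho> < 1 \<and>
       (\<forall>k0 k. k0 \<le> k \<longrightarrow>
         (\<forall>\<xi> \<in> l2_adapted M w (int k0 - 1).
            (LINT \<omega>|M. (norm (trajectory F G w k0 \<xi> k \<omega>))\<^sup>2)
              \<le> \<beta> * (LINT \<omega>|M. (norm (\<xi> \<omega>))\<^sup>2) * \<rho> ^ (k - k0))))"

definition positive_definite :: "real ^ 'n ^ 'n \<Rightarrow> bool" where
  "positive_definite A \<longleftrightarrow> transpose A = A \<and> (\<forall>x. x \<noteq> 0 \<longrightarrow> x \<bullet> (A *v x) > 0)"

end

theory Submission
  imports Defs
begin

text \<open>Second moments turn the stochastic system into a deterministic linear one. Since \<open>w k\<close> is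
  independent of the state \<open>x k\<close>, centred and of unit variance, the expectation of a quadratic
  form \<open>Q\<close> at \<open>x (k + 1)\<close> equals that of \<open>F\<^sup>T Q F + G\<^sup>T Q G\<close> at \<open>x k\<close>
  (\<open>trajectory_moments\<close> iterates this). Hence ESMS says that the pullback over \<open>d\<close> steps of
  the identity form decays exponentially in \<open>d\<close>, uniformly in the starting time.

  Fix a starting time \<open>k\<close> and let \<open>B\<close> be the pullback over one period. A separating hyperplane
  gives an alternative (\<open>lyapunov_alternative\<close>): either there is a nonnegative form \<open>Y\<close> that
  \<open>B\<close> strictly decreases, or there is a second moment matrix \<open>X\<close> of trace one, a convex
  combination of matrices \<open>v v\<^sup>T\<close>, that does not shrink over a period in the order dual to
  nonnegative forms. A form \<open>Y\<close> is a Lyapunov function, and the pullbacks of the identity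
  decay geometrically (\<open>lyapunov_contraction\<close>).

  A matrix \<open>X\<close> cannot exist. The Lyapunov equation telescopes: the total output energy started
  from \<open>X\<close> is at most the pairing of \<open>P k\<close> with \<open>X\<close>, hence finite. The energy spent at
  corresponding times of successive periods does not decrease, so all of it is zero
  (\<open>growing_imp_no_output\<close>). Energies are nonnegative on each \<open>v v\<^sup>T\<close>, so every deterministic
  state \<open>v\<close> occurring in \<open>X\<close> with positive weight has no output, is unobservable, and decays by
  exact detectability; thus the trace of the moments started from \<open>X\<close> tends to zero
  (\<open>detectable_convex_hull\<close>). But along periods this trace stays at least one.

  Periodicity leaves finitely many phases to consider, which makes the decay uniform in the
  starting time (\<open>uniform_exponential_decay\<close>).\<close>

section \<open>Quadratic forms\<close>

definition qform :: "real ^ 'n ^ 'n \<Rightarrow> real ^ 'n \<Rightarrow> real" where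
  "qform Q v = v \<bullet> (Q *v v)"

definition nonneg_form :: "real ^ 'n ^ 'n \<Rightarrow> bool" where
  "nonneg_form Q \<longleftrightarrow> (\<forall>v. 0 \<le> qform Q v)"

text \<open>Pairing with \<open>outer v\<close> evaluates a form at \<open>v\<close>, so the inner product on matrices pairs forms
  with second moments.\<close>

definition outer :: "real ^ 'n \<Rightarrow> real ^ 'n ^ 'n" where
  "outer v = (\<chi> i j. v $ i * v $ j)"

lemma inner_outer: "Q \<bullet> outer v = qform Q v"
  by (simp add: outer_def qform_def inner_vec_def matrix_vector_mult_def sum_distrib_left
      mult_ac)

lemma qform_0: "qform 0 v = 0"
  by (simp add: qform_def)

lemma qform_add: "qform (Q + R) v = qform Q v + qform R v"
  by (simp add: inner_add_left flip: inner_outer)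

lemma qform_scaleR: "qform (c *\<^sub>R Q) v = c * qform Q v"
  by (simp flip: inner_outer)

lemma qform_scale_vector: "qform Q (c *\<^sub>R v) = c\<^sup>2 * qform Q v"
  by (simp add: qform_def matrix_vector_mult_scaleR power2_eq_square)

lemma qform_mat_1: "qform (mat 1) v = (norm v)\<^sup>2"
  by (simp add: qform_def power2_norm_eq_inner)

lemma qform_gram: "qform (transpose H ** H) v = (norm (H *v v))\<^sup>2"
  by (simp add: qform_def power2_norm_eq_inner dot_lmul_matrix flip: matrix_vector_mul_assoc)
     (metis dot_lmul_matrix inner_commute)

lemma qform_congruence: "qform (transpose A ** Q ** A) v = qform Q (A *v v)"
  by (simp add: qform_def flip: matrix_vector_mul_assoc)
     (metis dot_lmul_matrix inner_commute)

lemma bilinear_form_bound: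
  fixes A B :: "real ^ 'n ^ 'm"
  shows "\<bar>(A *v v) \<bullet> (B *v v)\<bar> \<le> onorm ((*v) A) * onorm ((*v) B) * (norm v)\<^sup>2"
proof -
  have bl: "bounded_linear ((*v) A)" "bounded_linear ((*v) B)"
    by auto
  have "\<bar>(A *v v) \<bullet> (B *v v)\<bar> \<le> norm (A *v v) * norm (B *v v)"
    by (rule Cauchy_Schwarz_ineq2)
  also have "\<dots> \<le> (onorm ((*v) A) * norm v) * (onorm ((*v) B) * norm v)"
    by (intro mult_mono onorm bl mult_nonneg_nonneg onorm_pos_le) auto
  finally show ?thesis
    by (simp add: power2_eq_square mult_ac)
qed

lemma qform_upper_bound:
  obtains C where "\<And>v. qform Q v \<le> C * (norm v)\<^sup>2"
proof (rule that)
  show "qform Q v \<le> onorm ((*v) (mat 1 :: real ^ 'a ^ 'a)) * onorm ((*v) Q) * (norm v)\<^sup>2" for v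
    using bilinear_form_bound[of "mat 1" v Q] by (simp add: qform_def)
qed

section \<open>The pullback of quadratic forms along the dynamics\<close>

definition step_pullback :: "(nat \<Rightarrow> real ^ 'n ^ 'n) \<Rightarrow> (nat \<Rightarrow> real ^ 'n ^ 'n) \<Rightarrow> nat \<Rightarrow>
    real ^ 'n ^ 'n \<Rightarrow> real ^ 'n ^ 'n" where
  "step_pullback F G k Q = transpose (F k) ** Q ** F k + transpose (G k) ** Q ** G k"

lemma qform_step_pullback:
  "qform (step_pullback F G k Q) v = qform Q (F k *v v) + qform Q (G k *v v)"
  by (simp add: step_pullback_def qform_add qform_congruence)

lemma linear_step_pullback: "linear (step_pullback F G k)"
  by (rule linearI)
     (simp_all add: step_pullback_def vec_eq_iff matrix_matrix_mult_def sum.distrib algebra_simps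
        sum_distrib_left)

text \<open>The step at the latest time is pulled back first, so the recursion peels off steps at the far
  end of the time interval.\<close>

primrec pullback :: "(nat \<Rightarrow> real ^ 'n ^ 'n) \<Rightarrow> (nat \<Rightarrow> real ^ 'n ^ 'n) \<Rightarrow> nat \<Rightarrow> nat \<Rightarrow>
    real ^ 'n ^ 'n \<Rightarrow> real ^ 'n ^ 'n" where
  "pullback F G k 0 Q = Q"
| "pullback F G k (Suc d) Q = pullback F G k d (step_pullback F G (k + d) Q)"

lemma linear_pullback: "linear (pullback F G k d)"
proof (induction d)
  case 0
  show ?case by (simp add: linear_iff)
next
  case (Suc d)
  show ?case
    using linear_compose[OF linear_step_pullback[of F G "k + d"] Suc] by (simp add: o_def)
qed

lemma pullback_add:
  "pullback F G k (d + e) Q = pullback F G k d (pullback F G (k + d) e Q)"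
  by (induction e arbitrary: Q) (simp_all add: add.assoc)

lemma pullback_mono:
  assumes "\<And>v. qform Q v \<le> qform R v"
  shows "qform (pullback F G k d Q) v \<le> qform (pullback F G k d R) v"
  using assms
proof (induction d arbitrary: Q R)
  case (Suc d)
  then show ?case
    by (simp add: Suc.IH qform_step_pullback add_mono)
qed simp

lemma pullback_mono_scaleR:
  assumes "\<And>v. qform Q v \<le> c * qform R v"
  shows "qform (pullback F G k d Q) v \<le> c * qform (pullback F G k d R) v"
  using pullback_mono[of Q "c *\<^sub>R R" F G k d v] assms
  by (simp add: qform_scaleR linear_cmul[OF linear_pullback])

lemma pullback_nonneg: "nonneg_form Q \<Longrightarrow> nonneg_form (pullback F G k d Q)"
  using pullback_mono[of 0 Q F G k d]
  by (simp add: nonneg_form_def qform_0 linear_0[OF linear_pullback])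

text \<open>Only the phase of the starting time matters.\<close>

lemma pullback_periodic:
  assumes "\<And>k. F (k + \<tau>) = F k" "\<And>k. G (k + \<tau>) = G k"
  shows "pullback F G (k + j * \<tau>) d Q = pullback F G k d Q"
proof -
  have F: "F (i + j * \<tau>) = F i" and G: "G (i + j * \<tau>) = G i" for i
    by (induction j) (simp_all add: add.assoc[symmetric] assms add.commute[of \<tau>])
  have l: "step_pullback F G (k + j * \<tau> + d) = step_pullback F G (k + d)" for d
    using F[of "k+d"] G[of "k+d"] by (simp add: step_pullback_def fun_eq_iff add_ac)
  show ?thesis
    by (induction d arbitrary: Q) (simp_all add: l)
qed

section \<open>Lyapunov functions and growing second moments\<close>

lemma inner_convex_hull_outer_nonneg:
  assumes "X \<in> convex hull (outer ` S)" "nonneg_form Q"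
  shows "0 \<le> Q \<bullet> X"
proof -
  have "convex hull (outer ` S) \<subseteq> {X. Q \<bullet> X \<ge> 0}"
    using assms(2)
    by (intro hull_minimal convex_halfspace_ge) (auto simp: inner_outer nonneg_form_def)
  then show ?thesis
    using assms(1) by auto
qed

lemma compact_outer_sphere: "compact (outer ` sphere (0::real^'n) 1)"
  unfolding outer_def
  by (intro compact_continuous_image compact_sphere continuous_intros)

text \<open>A theorem of alternatives that takes the place of a Perron--Frobenius (Krein--Rutman) argument
  for the cone of positive semidefinite matrices. Write \<open>T\<close> for \<open>X - adjoint B X\<close>; the values
  of \<open>T\<close> on moments of trace one form a compact convex set. Either this set meets the closed
  convex cone \<open>N\<close> of matrices that pair nonpositively with all nonnegative forms, which is the
  growing case, or a hyperplane strictly separates the two, and its normal is the Lyapunov form.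
  Defining \<open>N\<close> by duality makes its closedness immediate and avoids the spectral theorem.\<close>

lemma lyapunov_alternative:
  fixes B :: "real ^ 'n ^ 'n \<Rightarrow> real ^ 'n ^ 'n"
  assumes lin: "linear B"
  obtains (lyapunov) Y b where "b > 0" "nonneg_form Y"
      "\<And>v. qform (B Y) v \<le> qform Y v - b * (norm v)\<^sup>2"
    | (growing) X where "X \<in> convex hull (outer ` sphere 0 1)"
      "\<And>Q. nonneg_form Q \<Longrightarrow> Q \<bullet> X \<le> B Q \<bullet> X"
proof -
  define K :: "(real ^ 'n ^ 'n) set" where "K = convex hull (outer ` sphere 0 1)"
  define T where "T = (\<lambda>X. X - adjoint B X)"
  define N :: "(real ^ 'n ^ 'n) set" where "N = {W. \<forall>Q. nonneg_form Q \<longrightarrow> Q \<bullet> W \<le> 0}"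
  have T: "Q \<bullet> T X = Q \<bullet> X - B Q \<bullet> X" for Q X
    by (simp add: T_def inner_diff_right adjoint_works[OF lin])
  have linT: "linear T"
    unfolding T_def by (intro linear_compose_sub linear_id[unfolded id_def] adjoint_linear lin)
  show ?thesis
  proof (cases "N \<inter> T ` K = {}")
    case False
    then obtain X where "X \<in> K" "T X \<in> N"
      by auto
    then show ?thesis
      using growing[of X] T by (force simp: N_def K_def)
  next
    case True
    have N: "N = (\<Inter>Q\<in>Collect nonneg_form. {W. Q \<bullet> W \<le> 0})"
      by (auto simp: N_def)
    have "convex N" "closed N"
      unfolding N by (auto intro!: convex_INT convex_halfspace_le closed_halfspace_le)
    moreover have "convex (T ` K)" "compact (T ` K)"
      unfolding K_def
      by (auto intro!: convex_linear_image compact_continuous_image linear_continuous_on linT convex_convex_hull 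
            compact_convex_hull compact_outer_sphere simp: linear_linear)
    moreover have "T ` K \<noteq> {}"
      by (simp add: K_def)
    ultimately obtain Y b where Y: "\<And>W. W \<in> N \<Longrightarrow> Y \<bullet> W < b" "\<And>X. X \<in> K \<Longrightarrow> b < Y \<bullet> T X"
      using separating_hyperplane_closed_compact[of N "T ` K"] True by (metis imageI)
    have "b > 0"
      using Y(1)[of 0] by (simp add: N_def)
    moreover have "nonneg_form Y"
      unfolding nonneg_form_def
    proof (rule allI, rule ccontr)
      fix v
      assume neg: "\<not> 0 \<le> qform Y v"
      \<comment> \<open>The multiple of \<open>- outer v\<close> that the normal would map exactly onto the bound \<open>b\<close>.\<close>
      define t where "t = b / - qform Y v"
      have "t \<ge> 0"
        using neg \<open>b > 0\<close> by (simp add: t_def divide_nonneg_neg)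
      then have "- t *\<^sub>R outer v \<in> N"
        by (auto simp: N_def inner_outer nonneg_form_def)
      from Y(1)[OF this] show False
        using neg by (simp add: inner_outer t_def)
    qed
    moreover have "qform (B Y) v \<le> qform Y v - b * (norm v)\<^sup>2" for v
    proof (cases "v = 0")
      case False
      define u where "u = v /\<^sub>R norm v"
      have v: "v = norm v *\<^sub>R u" and "norm u = 1"
        using False by (simp_all add: u_def)
      then have "outer u \<in> K"
        by (auto simp: K_def intro: hull_inc)
      from Y(2)[OF this] have "qform (B Y) u \<le> qform Y u - b"
        by (simp add: T inner_outer)
      from mult_left_mono[OF this, of "(norm v)\<^sup>2"] show ?thesis
        by (subst (1 2) v) (simp add: qform_scale_vector algebra_simps)
    qed (simp add: qform_def)
    ultimately show ?thesis
      by (rule lyapunov)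
  qed
qed

text \<open>Since \<open>Y\<close> is bounded above by a multiple of the squared norm, the strict decrease is by a fixed
  factor \<open>r < 1\<close>. It also bounds \<open>Y\<close> below by \<open>b\<close> times the squared norm, because the
  pullback of \<open>Y\<close> is nonnegative, and so the decay of \<open>Y\<close> passes to the identity.\<close>

lemma lyapunov_contraction:
  fixes F G :: "nat \<Rightarrow> real ^ 'n ^ 'n"
  assumes per: "\<And>k. F (k + \<tau>) = F k" "\<And>k. G (k + \<tau>) = G k"
    and b: "b > 0" and Y: "nonneg_form Y"
    and decr: "\<And>v. qform (pullback F G k \<tau> Y) v \<le> qform Y v - b * (norm v)\<^sup>2"
  shows "\<exists>J. \<forall>j\<ge>J. \<forall>v. qform (pullback F G k (j * \<tau>) (mat 1)) v \<le> (norm v)\<^sup>2 / 2"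
proof -
  obtain C0 where C0: "\<And>v. qform Y v \<le> C0 * (norm v)\<^sup>2"
    using qform_upper_bound by blast
  \<comment> \<open>The maximum with \<open>b\<close> ensures that \<open>r\<close> below lies in \<open>[0, 1)\<close>.\<close>
  define C where "C = max b C0"
  have C: "qform Y v \<le> C * (norm v)\<^sup>2" for v
    using C0[of v] mult_right_mono[of C0 C "(norm v)\<^sup>2"] by (simp add: C_def)
  have "C \<ge> b" "C > 0"
    using b by (simp_all add: C_def)
  define r where "r = 1 - b / C"
  have r: "0 \<le> r" "r < 1"
    using \<open>C \<ge> b\<close> \<open>C > 0\<close> b by (simp_all add: r_def)
  have step: "qform (pullback F G k \<tau> Y) v \<le> r * qform Y v" for v
  proof -
    have "b / C * qform Y v \<le> b / C * (C * (norm v)\<^sup>2)"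
      using b \<open>C > 0\<close> C by (intro mult_left_mono) auto
    then show ?thesis
      using decr[of v] \<open>C > 0\<close> by (simp add: r_def algebra_simps)
  qed
  have lower: "(norm v)\<^sup>2 \<le> 1 / b * qform Y v" for v
  proof -
    have "0 \<le> qform (pullback F G k \<tau> Y) v"
      using pullback_nonneg[OF Y] by (simp add: nonneg_form_def)
    then show ?thesis
      using decr[of v] b by (simp add: field_simps)
  qed
  have pow: "qform (pullback F G k (j * \<tau>) Y) v \<le> r ^ j * qform Y v" for j v
  proof (induction j)
    case (Suc j)
    have "qform (pullback F G k (Suc j * \<tau>) Y) v
        = qform (pullback F G k (j * \<tau>) (pullback F G k \<tau> Y)) v"
      using pullback_add[of F G k "j * \<tau>" \<tau>] pullback_periodic[of F \<tau> G, OF per] by (simp add: add.commute)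
    also have "\<dots> \<le> r * qform (pullback F G k (j * \<tau>) Y) v"
      by (intro pullback_mono_scaleR step)
    also have "\<dots> \<le> r * (r ^ j * qform Y v)"
      by (intro mult_left_mono Suc r)
    finally show ?case by (simp add: mult_ac)
  qed simp
  have "(\<lambda>j. C / b * r ^ j) \<longlonglongrightarrow> C / b * 0"
    using r by (intro tendsto_mult_left LIMSEQ_realpow_zero) auto
  then have "eventually (\<lambda>j. C / b * r ^ j < 1 / 2) sequentially"
    by (intro order_tendstoD) auto
  then obtain J where J: "\<And>j. j \<ge> J \<Longrightarrow> C / b * r ^ j < 1 / 2"
    by (auto simp: eventually_sequentially)
  have "qform (pullback F G k (j * \<tau>) (mat 1)) v \<le> (norm v)\<^sup>2 / 2" if "j \<ge> J" for j v
  proof -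
    have "qform (pullback F G k (j * \<tau>) (mat 1)) v \<le> 1 / b * qform (pullback F G k (j * \<tau>) Y) v"
      by (intro pullback_mono_scaleR) (use lower in \<open>simp add: qform_mat_1\<close>)
    also have "\<dots> \<le> 1 / b * (r ^ j * (C * (norm v)\<^sup>2))"
      using b r by (intro mult_left_mono order_trans[OF pow] C) auto
    also have "\<dots> = (C / b * r ^ j) * (norm v)\<^sup>2"
      by simp
    also have "\<dots> \<le> 1 / 2 * (norm v)\<^sup>2"
      using J[OF that] by (intro mult_right_mono) auto
    finally show ?thesis by simp
  qed
  then show ?thesis by blast
qed

lemma null_sequence_subharmonic_nonpos:
  fixes a :: "nat \<Rightarrow> real"
  assumes lim: "a \<longlonglongrightarrow> 0" and "\<tau> > 0" and grow: "\<And>d. a d \<le> a (d + \<tau>)"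
  shows "a d \<le> 0"
proof -
  have le: "a d \<le> a (d + j * \<tau>)" for j
  proof (induction j)
    case (Suc j)
    show ?case
      using Suc grow[of "d + j * \<tau>"] by (simp add: add_ac)
  qed simp
  have "strict_mono (\<lambda>j. d + j * \<tau>)"
    using \<open>\<tau> > 0\<close> by (simp add: strict_mono_def)
  from LIMSEQ_subseq_LIMSEQ[OF lim this] show ?thesis
    using le by (intro LIMSEQ_le_const[of "\<lambda>j. a (d + j * \<tau>)"]) (auto simp: o_def)
qed

text \<open>The sequence \<open>h\<close> below is the output energy at time \<open>k + d\<close>. Telescoping the Lyapunov equation
  makes it summable, whatever the size of the later \<open>P\<close>, while the growth of \<open>X\<close> prevents it
  from decreasing over a period.\<close>

lemma growing_imp_no_output:
  fixes F G P S :: "nat \<Rightarrow> real ^ 'n ^ 'n"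
  assumes "\<tau> > 0" and per: "\<And>k. F (k + \<tau>) = F k" "\<And>k. G (k + \<tau>) = G k" "\<And>k. S (k + \<tau>) = S k"
    and P: "\<And>k. nonneg_form (P k)" and S: "\<And>k. nonneg_form (S k)"
    and eq: "\<And>k. P k = step_pullback F G k (P (Suc k)) + S k"
    and X: "X \<in> convex hull (outer ` U)"
    and grow: "\<And>Q. nonneg_form Q \<Longrightarrow> Q \<bullet> X \<le> pullback F G k \<tau> Q \<bullet> X"
  shows "pullback F G k d (S (k + d)) \<bullet> X = 0"
proof -
  define h where "h = (\<lambda>d. pullback F G k d (S (k + d)) \<bullet> X)"
  have nonneg: "0 \<le> pullback F G k d Q \<bullet> X" if "nonneg_form Q" for d Q
    using that by (intro inner_convex_hull_outer_nonneg[OF X] pullback_nonneg)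
  have telescope: "(\<Sum>d<D. h d) + pullback F G k D (P (k + D)) \<bullet> X = P k \<bullet> X" for D
  proof (induction D)
    case (Suc D)
    have "pullback F G k D (P (k + D)) =
        pullback F G k (Suc D) (P (k + Suc D)) + pullback F G k D (S (k + D))"
      by (subst eq) (simp add: linear_add[OF linear_pullback])
    then show ?case
      using Suc by (simp add: h_def inner_add_left)
  qed simp
  have "summable h"
  proof (rule summableI_nonneg_bounded)
    show "0 \<le> h d" for d
      by (simp add: h_def nonneg S)
    show "sum h {..<D} \<le> P k \<bullet> X" for D
      using telescope[of D] nonneg[OF P, of D "k + D"] by simp
  qed
  then have "h \<longlonglongrightarrow> 0"
    by (rule summable_LIMSEQ_zero)
  moreover have "h d \<le> h (d + \<tau>)" for d
  proof -
    have "h (d + \<tau>) = pullback F G k \<tau> (pullback F G k d (S (k + d))) \<bullet> X"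
      using pullback_add[of F G k \<tau> d "S (k + d)"] pullback_periodic[of F \<tau> G k 1, OF per(1,2)]
        per(3)[of "k + d"]
      by (simp add: h_def add_ac)
    then show ?thesis
      using grow[OF pullback_nonneg[OF S]] by (simp add: h_def)
  qed
  ultimately have "h d \<le> 0"
    using \<open>\<tau> > 0\<close> null_sequence_subharmonic_nonpos by blast
  then show ?thesis
    using nonneg[OF S, of d "k + d"] by (simp add: h_def)
qed

text \<open>The implication from vanishing energies to decay holds at each \<open>outer v\<close>. It survives convex
  combinations because energies are nonnegative: if they vanish on a combination, they vanish on
  each part that has positive weight.\<close>

lemma detectable_convex_hull:
  fixes R S :: "nat \<Rightarrow> real ^ 'n ^ 'n"
  assumes S: "\<And>d. nonneg_form (S d)"
    and detect: "\<And>v. (\<And>d. qform (S d) v = 0) \<Longrightarrow> (\<lambda>d. qform (R d) v) \<longlonglongrightarrow> 0"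
    and X: "X \<in> convex hull (outer ` U)" and zero: "\<And>d. S d \<bullet> X = 0"
  shows "(\<lambda>d. R d \<bullet> X) \<longlonglongrightarrow> 0"
proof -
  define good where "good = (\<lambda>X. (\<forall>d. 0 \<le> S d \<bullet> X) \<and>
      ((\<forall>d. S d \<bullet> X = 0) \<longrightarrow> (\<lambda>d. R d \<bullet> X) \<longlonglongrightarrow> 0))"
  have "convex {X. good X}"
  proof (rule convexI)
    fix X Y and s t :: real
    assume XY: "X \<in> {X. good X}" "Y \<in> {X. good X}" and st: "0 \<le> s" "0 \<le> t" "s + t = 1"
    have lim: "(\<lambda>d. c * (R d \<bullet> Z)) \<longlonglongrightarrow> 0"
      if "good Z" "\<forall>d. c * (S d \<bullet> Z) = 0" for Z and c :: real
      using that by (cases "c = 0") (auto simp: good_def intro: tendsto_mult_right_zero)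
    have "(\<lambda>d. R d \<bullet> (s *\<^sub>R X + t *\<^sub>R Y)) \<longlonglongrightarrow> 0"
      if z: "\<forall>d. S d \<bullet> (s *\<^sub>R X + t *\<^sub>R Y) = 0"
    proof -
      have "s * (S d \<bullet> X) = 0 \<and> t * (S d \<bullet> Y) = 0" for d
      proof -
        have "0 \<le> s * (S d \<bullet> X)" "0 \<le> t * (S d \<bullet> Y)"
          using XY st by (simp_all add: good_def)
        then show ?thesis
          using z[rule_format, of d] by (simp only: inner_add_right inner_scaleR_right) linarith
      qed
      then show ?thesis
        using tendsto_add[OF lim[of X s] lim[of Y t]] XY by (simp add: inner_add_right)
    qed
    then show "s *\<^sub>R X + t *\<^sub>R Y \<in> {X. good X}"
      using XY st by (simp add: good_def inner_add_right)
  qed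
  moreover have "good (outer v)" for v
    using S detect by (simp add: good_def inner_outer nonneg_form_def)
  ultimately have "good X"
    using hull_induct[OF X, of good] by auto
  then show ?thesis
    using zero by (simp add: good_def)
qed

text \<open>The growing case of \<open>lyapunov_alternative\<close> is contradictory: the pairing of \<open>X\<close> with the
  pulled-back identity would tend to zero by detectability, although it starts at one and does
  not decrease over a period.\<close>

lemma lyapunov_equation_contraction:
  fixes F G P S :: "nat \<Rightarrow> real ^ 'n ^ 'n"
  assumes "\<tau> > 0" and per: "\<And>k. F (k + \<tau>) = F k" "\<And>k. G (k + \<tau>) = G k" "\<And>k. S (k + \<tau>) = S k"
    and P: "\<And>k. nonneg_form (P k)" and S: "\<And>k. nonneg_form (S k)"
    and eq: "\<And>k. P k = step_pullback F G k (P (Suc k)) + S k"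
    and detect: "\<And>v. (\<And>d. qform (pullback F G k d (S (k + d))) v = 0) \<Longrightarrow>
        (\<lambda>d. qform (pullback F G k d (mat 1)) v) \<longlonglongrightarrow> 0"
  shows "\<exists>J. \<forall>j\<ge>J. \<forall>v. qform (pullback F G k (j * \<tau>) (mat 1)) v \<le> (norm v)\<^sup>2 / 2"
proof (rule lyapunov_alternative[OF linear_pullback[of F G k \<tau>]])
  fix Y b
  assume "b > 0" "nonneg_form Y"
    "\<And>v. qform (pullback F G k \<tau> Y) v \<le> qform Y v - b * (norm v)\<^sup>2"
  then show ?thesis
    using lyapunov_contraction[of F \<tau> G, OF per(1,2)] by blast
next
  fix X
  assume X: "X \<in> convex hull (outer ` sphere 0 1)"
    and grow: "\<And>Q. nonneg_form Q \<Longrightarrow> Q \<bullet> X \<le> pullback F G k \<tau> Q \<bullet> X"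
  have "pullback F G k d (S (k + d)) \<bullet> X = 0" for d
    using growing_imp_no_output[OF \<open>\<tau> > 0\<close> per P S eq X grow] .
  then have "(\<lambda>d. pullback F G k d (mat 1) \<bullet> X) \<longlonglongrightarrow> 0"
    using detect
    by (intro detectable_convex_hull[where S = "\<lambda>d. pullback F G k d (S (k + d))", OF _ _ X])
       (auto intro: pullback_nonneg S)
  moreover have "pullback F G k d (mat 1) \<bullet> X \<le> pullback F G k (d + \<tau>) (mat 1) \<bullet> X" for d
  proof -
    have "nonneg_form (pullback F G k d (mat 1))"
      by (rule pullback_nonneg) (simp add: nonneg_form_def qform_mat_1)
    from grow[OF this] show ?thesis
      using pullback_add[of F G k \<tau> d] pullback_periodic[of F \<tau> G k 1, OF per(1,2)]
      by (simp add: add.commute)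
  qed
  ultimately have "pullback F G k 0 (mat 1) \<bullet> X \<le> 0"
    using \<open>\<tau> > 0\<close> null_sequence_subharmonic_nonpos[where d = 0] by blast
  \<comment> \<open>The pairing with the identity is the trace.\<close>
  moreover have "convex hull (outer ` sphere 0 1) \<subseteq> {X. mat 1 \<bullet> X = (1::real)}"
    by (intro hull_minimal convex_hyperplane) (auto simp: inner_outer qform_mat_1)
  ultimately show ?thesis
    using X by auto
qed

text \<open>Each phase has its own number of periods from which on the pulled-back identity is at most
  half the squared norm; a multiple \<open>m\<close> of the period that exceeds all of them works for every
  starting time. The steps left over after blocks of length \<open>m\<close> cost at most the factor
  \<open>C ^ m\<close>.\<close>

lemma uniform_exponential_decay:
  fixes F G :: "nat \<Rightarrow> real ^ 'n ^ 'n"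
  assumes "\<tau> > 0" and per: "\<And>k. F (k + \<tau>) = F k" "\<And>k. G (k + \<tau>) = G k"
    and contr: "\<And>k. \<exists>J. \<forall>j\<ge>J. \<forall>v. qform (pullback F G k (j * \<tau>) (mat 1)) v \<le> (norm v)\<^sup>2 / 2"
  obtains \<beta> \<rho> :: real where "\<beta> \<ge> 1" "0 < \<rho>" "\<rho> < 1"
    "\<And>k d v. qform (pullback F G k d (mat 1)) v \<le> \<beta> * \<rho> ^ d * (norm v)\<^sup>2"
proof -
  have phase: "pullback F G k d Q = pullback F G (k mod \<tau>) d Q" for k d Q
    using pullback_periodic[of F \<tau> G "k mod \<tau>" "k div \<tau>" d Q, OF per] by simp
  obtain J where J: "\<And>k j v. j \<ge> J k \<Longrightarrow> qform (pullback F G k (j * \<tau>) (mat 1)) v \<le> (norm v)\<^sup>2 / 2"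
    using contr by metis
  define m where "m = (1 + (\<Sum>r<\<tau>. J r)) * \<tau>"
  have "m > 0"
    using \<open>\<tau> > 0\<close> by (simp add: m_def)
  have half: "qform (pullback F G k m (mat 1)) v \<le> 1 / 2 * qform (mat 1) v" for k v
  proof -
    have "J (k mod \<tau>) \<le> 1 + (\<Sum>r<\<tau>. J r)"
      using \<open>\<tau> > 0\<close> member_le_sum[of "k mod \<tau>" "{..<\<tau>}" J] by simp
    then show ?thesis
      using J[where k = "k mod \<tau>", of "1 + (\<Sum>r<\<tau>. J r)" v]
      by (subst phase) (simp add: m_def qform_mat_1)
  qed
  have "\<exists>C. \<forall>v. qform (step_pullback F G k (mat 1)) v \<le> C * (norm v)\<^sup>2" for k
    using qform_upper_bound by metis
  then obtain c where c: "\<And>k v. qform (step_pullback F G k (mat 1)) v \<le> c k * (norm v)\<^sup>2"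
    by metis
  define C where "C = 1 + (\<Sum>r<\<tau>. \<bar>c r\<bar>)"
  have "C \<ge> 1"
    by (simp add: C_def sum_nonneg)
  have one: "qform (step_pullback F G k (mat 1)) v \<le> C * qform (mat 1) v" for k v
  proof -
    have "c (k mod \<tau>) \<le> C"
      using \<open>\<tau> > 0\<close> member_le_sum[of "k mod \<tau>" "{..<\<tau>}" "\<lambda>r. \<bar>c r\<bar>"] by (simp add: C_def)
    then have "c (k mod \<tau>) * (norm v)\<^sup>2 \<le> C * (norm v)\<^sup>2"
      by (simp add: mult_right_mono)
    then show ?thesis
      using c[of "k mod \<tau>" v] phase[of k 1 "mat 1"] by (simp add: qform_mat_1)
  qed
  have Cpow: "qform (pullback F G k i (mat 1)) v \<le> C ^ i * qform (mat 1) v" for i k v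
  proof (induction i)
    case (Suc i)
    have "qform (pullback F G k (Suc i) (mat 1)) v \<le> C * qform (pullback F G k i (mat 1)) v"
      by (simp, intro pullback_mono_scaleR one)
    also have "\<dots> \<le> C * (C ^ i * qform (mat 1) v)"
      using \<open>C \<ge> 1\<close> Suc by (intro mult_left_mono) auto
    finally show ?case by (simp add: mult_ac)
  qed simp
  have halfpow: "qform (pullback F G k (j * m) (mat 1)) v \<le> (1 / 2) ^ j * (norm v)\<^sup>2" for j k v
  proof (induction j)
    case (Suc j)
    have "qform (pullback F G k (Suc j * m) (mat 1)) v
        = qform (pullback F G k (j * m) (pullback F G (k + j * m) m (mat 1))) v"
      using pullback_add[of F G k "j * m" m] by (simp add: add.commute)
    also have "\<dots> \<le> 1 / 2 * qform (pullback F G k (j * m) (mat 1)) v"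
      by (intro pullback_mono_scaleR half)
    also have "\<dots> \<le> 1 / 2 * ((1 / 2) ^ j * (norm v)\<^sup>2)"
      by (intro mult_left_mono Suc) auto
    finally show ?case by simp
  qed (simp add: qform_mat_1)
  \<comment> \<open>The rate per step that halves over a block of length \<open>m\<close>; the factor 2 in the final constant
    pays for an incomplete last block.\<close>
  define \<rho> where "\<rho> = root m (1 / 2)"
  have \<rho>: "0 < \<rho>" "\<rho> < 1" "\<rho> ^ m = 1 / 2"
    using \<open>m > 0\<close> by (simp_all add: \<rho>_def)
  show ?thesis
  proof (rule that[of "2 * C ^ m" \<rho>])
    show "1 \<le> 2 * C ^ m"
      using one_le_power[OF \<open>C \<ge> 1\<close>, of m] by linarith
    fix k d v
    define j i where "j = d div m" and "i = d mod m"
    have d: "d = j * m + i" and "i < m"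
      using \<open>m > 0\<close> by (simp_all add: j_def i_def)
    have "(1 / 2) ^ j * \<rho> ^ m \<le> (1 / 2) ^ j * \<rho> ^ i"
      using \<rho> \<open>i < m\<close> by (intro mult_left_mono power_decreasing) auto
    also have "\<dots> = \<rho> ^ d"
      by (simp add: d power_add power_mult mult.commute[of j m] \<rho>(3))
    finally have decay: "(1 / 2) ^ j \<le> 2 * \<rho> ^ d"
      using \<rho>(3) by simp
    have "qform (pullback F G k d (mat 1)) v
        = qform (pullback F G k (j * m) (pullback F G (k + j * m) i (mat 1))) v"
      by (simp add: d pullback_add)
    also have "\<dots> \<le> C ^ i * qform (pullback F G k (j * m) (mat 1)) v"
      by (intro pullback_mono_scaleR Cpow)
    also have "\<dots> \<le> C ^ m * ((1 / 2) ^ j * (norm v)\<^sup>2)"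
      using \<open>C \<ge> 1\<close> \<open>i < m\<close> pullback_nonneg[of "mat 1" F G k "j * m"]
      by (intro mult_mono halfpow power_increasing) (auto simp: nonneg_form_def qform_mat_1)
    also have "\<dots> \<le> C ^ m * (2 * \<rho> ^ d * (norm v)\<^sup>2)"
      using \<open>C \<ge> 1\<close> decay by (intro mult_left_mono mult_right_mono) auto
    finally show "qform (pullback F G k d (mat 1)) v \<le> 2 * C ^ m * \<rho> ^ d * (norm v)\<^sup>2"
      by (simp add: mult_ac)
  qed (use \<rho> in auto)
qed

section \<open>Independence of the past and the present noise\<close>

lemma (in white_noise) w_measurable [measurable]: "w k \<in> borel_measurable M"
  using indep by (auto simp: indep_vars_def)

lemma space_noise_filtration [simp]: "space (noise_filtration M w i) = space M"
  by (simp add: noise_filtration_def space_measure_of_conv)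

lemma sets_noise_filtration:
  "sets (noise_filtration M w i) =
     sigma_sets (space M) {w j -` A \<inter> space M | j A. int j \<le> i \<and> A \<in> sets borel}"
  unfolding noise_filtration_def by (intro sets_measure_of) auto

lemma (in white_noise) noise_filtration_le: "sets (noise_filtration M w i) \<subseteq> sets M"
  unfolding sets_noise_filtration by (intro sets.sigma_sets_subset) auto

lemma (in white_noise) measurable_noise_filtrationD:
  "x \<in> borel_measurable (noise_filtration M w i) \<Longrightarrow> x \<in> borel_measurable M"
  using noise_filtration_le[of i] by (auto simp: measurable_def)

lemma measurable_noise_filtration_mono:
  assumes "x \<in> borel_measurable (noise_filtration M w i)" "i \<le> j"
  shows "x \<in> borel_measurable (noise_filtration M w j)"
proof -
  have "sets (noise_filtration M w i) \<subseteq> sets (noise_filtration M w j)"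
    unfolding sets_noise_filtration using assms(2) by (intro sigma_sets_mono') force
  then show ?thesis
    using assms(1) by (auto simp: measurable_def)
qed

lemma noise_measurable_noise_filtration:
  "int k \<le> i \<Longrightarrow> w k \<in> borel_measurable (noise_filtration M w i)"
  by (rule measurableI) (auto simp: sets_noise_filtration intro!: sigma_sets.Basic)

text \<open>Grouping the independent sigma-algebras of the single noise variables into the past
  \<open>{..<k}\<close> and the present \<open>{k}\<close> keeps them independent, and the past generates the filtration
  at time \<open>k - 1\<close>.\<close>

lemma (in white_noise) indep_past_noise:
  fixes g :: "'a \<Rightarrow> real"
  assumes g: "g \<in> borel_measurable (noise_filtration M w (int k - 1))"
  shows "indep_var borel g borel (w k)"
proof -
  define E where "E = (\<lambda>i. {w i -` A \<inter> space M | A. A \<in> sets (borel :: real measure)})"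
  define I where "I = case_bool {..<k} {k}"
  have "indep_sets (\<lambda>b. sigma_sets (space M) (\<Union>i\<in>I b. E i)) UNIV"
  proof (rule indep_sets_collect_sigma)
    show "indep_sets E (\<Union>b\<in>UNIV. I b)"
      using indep unfolding indep_vars_def2 E_def
      by (auto intro: indep_sets_mono_index)
    show "Int_stable (E i)" for i
      unfolding E_def Int_stable_def by (auto, rule_tac x="A \<inter> Aa" in exI) auto
    show "disjoint_family_on I UNIV"
      by (auto simp: disjoint_family_on_def I_def split: bool.splits)
  qed
  then have "indep_sets (case_bool
      (sigma_sets (space M) {g -` A \<inter> space M | A. A \<in> sets borel})
      (sigma_sets (space M) {w k -` A \<inter> space M | A. A \<in> sets borel})) UNIV"
  proof (rule indep_sets_mono_sets)
    fix b :: bool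
    have past: "(\<Union>i\<in>{..<k}. E i) =
        {w j -` A \<inter> space M | j A. int j \<le> int k - 1 \<and> A \<in> sets borel}"
      by (auto simp: E_def)
    have "g -` A \<inter> space M \<in> sigma_sets (space M) (\<Union>i\<in>{..<k}. E i)" if "A \<in> sets borel" for A
      using measurable_sets[OF g that] unfolding past sets_noise_filtration[symmetric] by simp
    then have "sigma_sets (space M) {g -` A \<inter> space M | A. A \<in> sets borel} \<subseteq>
        sigma_sets (space M) (\<Union>i\<in>{..<k}. E i)"
      by (intro sigma_sets_mono) auto
    then show "(case b of
        True \<Rightarrow> sigma_sets (space M) {g -` A \<inter> space M | A. A \<in> sets borel}
      | False \<Rightarrow> sigma_sets (space M) {w k -` A \<inter> space M | A. A \<in> sets borel})
      \<subseteq> sigma_sets (space M) (\<Union>i\<in>I b. E i)"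
      by (auto simp: I_def E_def split: bool.split)
  qed
  then show ?thesis
    using measurable_noise_filtrationD[OF g] w_measurable by (simp add: indep_var_eq indep_set_def)
qed

lemma (in white_noise) noise_integrable: "integrable M (w k)" "integrable M (\<lambda>\<omega>. (w k \<omega>)\<^sup>2)"
proof -
  show sq: "integrable M (\<lambda>\<omega>. (w k \<omega>)\<^sup>2)"
    using covariance[of k k] not_integrable_integral_eq[of M "\<lambda>\<omega>. w k \<omega> * w k \<omega>"]
    by (auto simp: power2_eq_square)
  then show "integrable M (w k)"
    by (rule square_integrable_imp_integrable[OF w_measurable])
qed

lemma (in white_noise) expectation_past_times_noise:
  fixes g :: "'a \<Rightarrow> real"
  assumes g: "g \<in> borel_measurable (noise_filtration M w (int k - 1))" "integrable M g"
  shows "integrable M (\<lambda>\<omega>. g \<omega> * w k \<omega>)" "expectation (\<lambda>\<omega>. g \<omega> * w k \<omega>) = 0"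
    "integrable M (\<lambda>\<omega>. g \<omega> * (w k \<omega>)\<^sup>2)" "expectation (\<lambda>\<omega>. g \<omega> * (w k \<omega>)\<^sup>2) = expectation g"
proof -
  note iv = indep_past_noise[OF g(1)]
  have iv2: "indep_var borel g borel (\<lambda>\<omega>. (w k \<omega>)\<^sup>2)"
    using indep_var_compose[OF iv, of "\<lambda>x. x" borel "\<lambda>x. x\<^sup>2" borel] by (simp add: o_def)
  show "integrable M (\<lambda>\<omega>. g \<omega> * w k \<omega>)" "integrable M (\<lambda>\<omega>. g \<omega> * (w k \<omega>)\<^sup>2)"
    by (rule indep_var_integrable; fact iv iv2 g noise_integrable)+
  show "expectation (\<lambda>\<omega>. g \<omega> * w k \<omega>) = 0"
    by (subst indep_var_lebesgue_integral[OF iv g(2) noise_integrable(1)]) (simp add: mean)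
  show "expectation (\<lambda>\<omega>. g \<omega> * (w k \<omega>)\<^sup>2) = expectation g"
    by (subst indep_var_lebesgue_integral[OF iv2 g(2) noise_integrable(2)])
       (use covariance[of k k] in \<open>simp add: power2_eq_square\<close>)
qed

section \<open>Second moments of trajectories\<close>

lemma (in white_noise) l2_bilinear:
  fixes x :: "'a \<Rightarrow> real ^ 'n" and A B :: "real ^ 'n ^ 'm"
  assumes "x \<in> l2_adapted M w i"
  shows "(\<lambda>\<omega>. (A *v x \<omega>) \<bullet> (B *v x \<omega>)) \<in> borel_measurable (noise_filtration M w i)"
    and "integrable M (\<lambda>\<omega>. (A *v x \<omega>) \<bullet> (B *v x \<omega>))"
proof -
  have x: "x \<in> borel_measurable (noise_filtration M w i)" "integrable M (\<lambda>\<omega>. (norm (x \<omega>))\<^sup>2)"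
    using assms by (simp_all add: l2_adapted_def)
  have "continuous_on UNIV (\<lambda>v. (A *v v) \<bullet> (B *v v))"
    by (intro continuous_intros linear_continuous_on) auto
  from borel_measurable_continuous_on[OF this x(1)]
  show m: "(\<lambda>\<omega>. (A *v x \<omega>) \<bullet> (B *v x \<omega>)) \<in> borel_measurable (noise_filtration M w i)" .
  show "integrable M (\<lambda>\<omega>. (A *v x \<omega>) \<bullet> (B *v x \<omega>))"
  proof (rule Bochner_Integration.integrable_bound)
    show "integrable M (\<lambda>\<omega>. onorm ((*v) A) * onorm ((*v) B) * (norm (x \<omega>))\<^sup>2)"
      using x(2) by simp
    show "AE \<omega> in M. norm ((A *v x \<omega>) \<bullet> (B *v x \<omega>))
        \<le> norm (onorm ((*v) A) * onorm ((*v) B) * (norm (x \<omega>))\<^sup>2)"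
      by (rule AE_I2) (simp add: order_trans[OF bilinear_form_bound abs_ge_self])
  qed (rule measurable_noise_filtrationD[OF m])
qed

text \<open>Expanding the form at the next state gives a term without noise, two cross terms linear in the
  noise, whose expectations vanish, and a term with the squared noise, whose expectation 1 leaves the
  coefficient unchanged.\<close>

lemma (in white_noise) l2_step:
  fixes F G :: "nat \<Rightarrow> real ^ 'n ^ 'n"
  assumes x: "x \<in> l2_adapted M w (int k - 1)"
  defines "y \<equiv> \<lambda>\<omega>. F k *v x \<omega> + w k \<omega> *\<^sub>R (G k *v x \<omega>)"
  shows "y \<in> l2_adapted M w (int k)"
    and "expectation (\<lambda>\<omega>. qform Q (y \<omega>)) = expectation (\<lambda>\<omega>. qform (step_pullback F G k Q) (x \<omega>))"
proof -
  have split: "qform Q (y \<omega>) = (F k *v x \<omega>) \<bullet> ((Q ** F k) *v x \<omega>)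
      + ((F k *v x \<omega>) \<bullet> ((Q ** G k) *v x \<omega>) * w k \<omega> + (G k *v x \<omega>) \<bullet> ((Q ** F k) *v x \<omega>) * w k \<omega>)
      + (G k *v x \<omega>) \<bullet> ((Q ** G k) *v x \<omega>) * (w k \<omega>)\<^sup>2" for Q \<omega>
    by (simp add: qform_def y_def matrix_vector_right_distrib matrix_vector_mult_scaleR
        inner_add_left inner_add_right power2_eq_square algebra_simps flip: matrix_vector_mul_assoc)
  note bl = l2_bilinear[OF x]
  note noise = expectation_past_times_noise[OF bl]
  have int: "integrable M (\<lambda>\<omega>. qform Q (y \<omega>))" for Q
    unfolding split by (intro Bochner_Integration.integrable_add bl noise)
  have pulled: "qform (step_pullback F G k Q) (x \<omega>) =
      (F k *v x \<omega>) \<bullet> ((Q ** F k) *v x \<omega>) + (G k *v x \<omega>) \<bullet> ((Q ** G k) *v x \<omega>)" for \<omega>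
    unfolding qform_step_pullback by (simp add: qform_def matrix_vector_mul_assoc)
  show "expectation (\<lambda>\<omega>. qform Q (y \<omega>)) = expectation (\<lambda>\<omega>. qform (step_pullback F G k Q) (x \<omega>))"
    unfolding split pulled by (simp add: bl(2) noise)
  have "x \<in> borel_measurable (noise_filtration M w (int k - 1))"
    using x by (simp add: l2_adapted_def)
  from measurable_noise_filtration_mono[OF this]
  have [measurable]: "x \<in> borel_measurable (noise_filtration M w (int k))"
    by simp
  have mult: "(\<lambda>\<omega>. A *v x \<omega>) \<in> borel_measurable (noise_filtration M w (int k))" for A :: "real^'n^'n"
    by (intro borel_measurable_continuous_on[of "(*v) A"] linear_continuous_on) auto
  have "y \<in> borel_measurable (noise_filtration M w (int k))"
    unfolding y_def
    by (intro borel_measurable_add borel_measurable_scaleR noise_measurable_noise_filtration mult) auto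
  then show "y \<in> l2_adapted M w (int k)"
    using int[of "mat 1"] by (simp add: l2_adapted_def qform_mat_1)
qed

lemma trajectory_start: "trajectory F G w k \<xi> k = \<xi>"
  by (cases k) auto

lemma (in white_noise) trajectory_moments:
  fixes F G :: "nat \<Rightarrow> real ^ 'n ^ 'n"
  assumes \<xi>: "\<xi> \<in> l2_adapted M w (int k - 1)"
  shows "trajectory F G w k \<xi> (k + d) \<in> l2_adapted M w (int (k + d) - 1)"
    and "expectation (\<lambda>\<omega>. qform Q (trajectory F G w k \<xi> (k + d) \<omega>)) =
         expectation (\<lambda>\<omega>. qform (pullback F G k d Q) (\<xi> \<omega>))"
proof -
  show mem: "trajectory F G w k \<xi> (k + d) \<in> l2_adapted M w (int (k + d) - 1)" for d
  proof (induction d)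
    case (Suc d)
    show ?case
      using l2_step(1)[OF Suc, of F G] by simp
  qed (simp add: trajectory_start \<xi>)
  show "expectation (\<lambda>\<omega>. qform Q (trajectory F G w k \<xi> (k + d) \<omega>)) =
         expectation (\<lambda>\<omega>. qform (pullback F G k d Q) (\<xi> \<omega>))"
  proof (induction d arbitrary: Q)
    case (Suc d)
    show ?case
      using l2_step(2)[OF mem[of d], of Q F G] Suc by simp
  qed (simp add: trajectory_start)
qed

section \<open>Exact detectability and mean square stability\<close>

lemma (in white_noise) const_l2_adapted: "(\<lambda>_. v) \<in> l2_adapted M w i"
  by (simp add: l2_adapted_def)

text \<open>Deterministic initial states are adapted at every time, and the expected squared output norm is
  the pulled-back output energy.\<close>

lemma (in white_noise) no_output_imp_unobservable:
  fixes F G :: "nat \<Rightarrow> real ^ 'n ^ 'n" and H :: "nat \<Rightarrow> real ^ 'n ^ 'm"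
  assumes zero: "\<And>d. qform (pullback F G k d (transpose (H (k + d)) ** H (k + d))) v = 0"
  shows "unobservable_state M w F G H k s (\<lambda>_. v)"
  unfolding unobservable_state_def
proof (intro conjI ballI const_l2_adapted)
  fix i
  assume "i \<in> {k..k + s}"
  then obtain d where i: "i = k + d"
    by (auto simp: le_iff_add)
  let ?x = "trajectory F G w k (\<lambda>_. v) i"
  have "expectation (\<lambda>\<omega>. (norm (H i *v ?x \<omega>))\<^sup>2) = 0"
    using trajectory_moments(2)[OF const_l2_adapted, of "transpose (H i) ** H i" F G k v d] zero
    by (simp add: i qform_gram)
  moreover have "integrable M (\<lambda>\<omega>. (norm (H i *v ?x \<omega>))\<^sup>2)"
    using l2_bilinear(2)[OF trajectory_moments(1)[OF const_l2_adapted, of F G k v d], of "H i" "H i"]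
    by (simp add: i power2_norm_eq_inner)
  ultimately show "AE \<omega> in M. H i *v ?x \<omega> = 0"
    by (subst (asm) integral_nonneg_eq_0_iff_AE) auto
qed

lemma (in white_noise) exactly_detectable_imp_decay:
  fixes F G :: "nat \<Rightarrow> real ^ 'n ^ 'n" and H :: "nat \<Rightarrow> real ^ 'n ^ 'm"
  assumes det: "exactly_detectable_at M w F G H k s"
    and zero: "\<And>d. qform (pullback F G k d (transpose (H (k + d)) ** H (k + d))) v = 0"
  shows "(\<lambda>d. qform (pullback F G k d (mat 1)) v) \<longlonglongrightarrow> 0"
proof -
  obtain \<beta> \<rho> :: real where \<rho>: "0 < \<rho>" "\<rho> < 1"
    and bound: "\<And>i. i \<ge> k \<Longrightarrow> expectation (\<lambda>\<omega>. (norm (trajectory F G w k (\<lambda>_. v) i \<omega>))\<^sup>2)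
        \<le> \<beta> * expectation (\<lambda>\<omega>. (norm v)\<^sup>2) * \<rho> ^ (i - k)"
    using det no_output_imp_unobservable[of F G k H v s, OF zero]
    unfolding exactly_detectable_at_def by blast
  have upper: "qform (pullback F G k d (mat 1)) v \<le> \<beta> * (norm v)\<^sup>2 * \<rho> ^ d" for d
    using bound[of "k + d"] trajectory_moments(2)[OF const_l2_adapted, of "mat 1" F G k v d]
    by (simp add: qform_mat_1 prob_space)
  have lower: "0 \<le> qform (pullback F G k d (mat 1)) v" for d
    using pullback_nonneg[of "mat 1" F G k d] by (simp add: nonneg_form_def qform_mat_1)
  have "(\<lambda>d. \<beta> * (norm v)\<^sup>2 * \<rho> ^ d) \<longlonglongrightarrow> 0"
    using \<rho> by (intro tendsto_mult_right_zero LIMSEQ_realpow_zero) auto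
  from tendsto_sandwich[OF _ _ tendsto_const this] show ?thesis
    using upper lower by auto
qed

lemma (in white_noise) uniform_decay_imp_ESMS:
  fixes F G :: "nat \<Rightarrow> real ^ 'n ^ 'n"
  assumes "\<beta> \<ge> 1" "0 < \<rho>" "\<rho> < 1"
    and decay: "\<And>k d v. qform (pullback F G k d (mat 1)) v \<le> \<beta> * \<rho> ^ d * (norm v)\<^sup>2"
  shows "ESMS M w F G"
  unfolding ESMS_def
proof (rule exI[of _ \<beta>], rule exI[of _ \<rho>], intro conjI allI impI ballI)
  fix k0 k :: nat and \<xi> :: "'a \<Rightarrow> real ^ 'n"
  assume "k0 \<le> k" and \<xi>: "\<xi> \<in> l2_adapted M w (int k0 - 1)"
  then obtain d where k: "k = k0 + d"
    by (auto simp: le_iff_add)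
  have "expectation (\<lambda>\<omega>. (norm (trajectory F G w k0 \<xi> k \<omega>))\<^sup>2)
      = expectation (\<lambda>\<omega>. qform (pullback F G k0 d (mat 1)) (\<xi> \<omega>))"
    using trajectory_moments(2)[OF \<xi>, of "mat 1" F G d] by (simp add: k qform_mat_1)
  also have "\<dots> \<le> expectation (\<lambda>\<omega>. \<beta> * \<rho> ^ d * (norm (\<xi> \<omega>))\<^sup>2)"
  proof (rule integral_mono[OF _ _ decay])
    show "integrable M (\<lambda>\<omega>. qform (pullback F G k0 d (mat 1)) (\<xi> \<omega>))"
      using l2_bilinear(2)[OF \<xi>, of "mat 1" "pullback F G k0 d (mat 1)"] by (simp add: qform_def)
    show "integrable M (\<lambda>\<omega>. \<beta> * \<rho> ^ d * (norm (\<xi> \<omega>))\<^sup>2)"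
      using \<xi> by (simp add: l2_adapted_def)
  qed
  finally show "expectation (\<lambda>\<omega>. (norm (trajectory F G w k0 \<xi> k \<omega>))\<^sup>2)
      \<le> \<beta> * expectation (\<lambda>\<omega>. (norm (\<xi> \<omega>))\<^sup>2) * \<rho> ^ (k - k0)"
    by (simp add: k mult_ac)
qed (use assms in auto)

theorem theorem3p2p1:
  fixes M :: "'a measure"
    and w :: "nat \<Rightarrow> 'a \<Rightarrow> real"
    and F G :: "nat \<Rightarrow> real ^ 'n ^ 'n"
    and H :: "nat \<Rightarrow> real ^ 'n ^ 'm"
    and P :: "nat \<Rightarrow> real ^ 'n ^ 'n"
    and \<tau> N :: nat
  assumes "white_noise M w"
    and "\<tau> > 0"
    and "\<And>k. F (k + \<tau>) = F k"
    and "\<And>k. G (k + \<tau>) = G k"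
    and "\<And>k. H (k + \<tau>) = H k"
    and "K_exactly_detectable M w F G H N"
    and "\<And>k. positive_definite (P k)"
    and "\<And>k. - P k + transpose (F k) ** P (k + 1) ** F k
              + transpose (G k) ** P (k + 1) ** G k
              + transpose (H k) ** H k = 0"
  shows "ESMS M w F G"
proof -
  interpret white_noise M w
    by fact
  define S where "S = (\<lambda>k. transpose (H k) ** H k)"
  have S: "nonneg_form (S k)" for k
    by (simp add: S_def nonneg_form_def qform_gram)
  have P: "nonneg_form (P k)" for k
    unfolding nonneg_form_def
  proof
    fix v
    show "0 \<le> qform (P k) v"
      using assms(7)[of k]
      by (cases "v = 0") (auto simp: positive_definite_def qform_def intro: less_imp_le)
  qed
  have eq: "P k = step_pullback F G k (P (Suc k)) + S k" for k
    using assms(8)[of k] by (simp add: step_pullback_def S_def algebra_simps)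
  have "\<exists>J. \<forall>j\<ge>J. \<forall>v. qform (pullback F G k (j * \<tau>) (mat 1)) v \<le> (norm v)\<^sup>2 / 2" for k
  proof (rule lyapunov_equation_contraction[of \<tau> F G S P, OF \<open>\<tau> > 0\<close> assms(3,4) _ P S eq])
    show "S (k + \<tau>) = S k" for k
      by (simp add: S_def assms(5))
    show "(\<lambda>d. qform (pullback F G k d (mat 1)) v) \<longlonglongrightarrow> 0"
      if "\<And>d. qform (pullback F G k d (S (k + d))) v = 0" for v
      using exactly_detectable_imp_decay[of F G H k N v] assms(6) that
      by (simp add: S_def K_exactly_detectable_def)
  qed
  then obtain \<beta> \<rho> :: real where "\<beta> \<ge> 1" "0 < \<rho>" "\<rho> < 1"
    "\<And>k d v. qform (pullback F G k d (mat 1)) v \<le> \<beta> * \<rho> ^ d * (norm v)\<^sup>2"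
    using uniform_exponential_decay[of \<tau> F G, OF \<open>\<tau> > 0\<close> assms(3,4)] by blast
  then show ?thesis
    by (rule uniform_decay_imp_ESMS)
qed

end
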